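(* Let $V$ be a strongly regular vertex operator algebra. Let $g$ be an automorphism of $V$ and $U$ an extension vertex operator algebra of $V$. Assume further that $V$, $g$ and $U$ satisfy the following conditions: (1) $U$ viewed as a $V$-module has the decomposition $U=M^0\oplus M^1\oplus\cdots\oplus M^k$ such that $M^0=V,M^1,\dots,M^k$ are nonisomorphic irreducible $V$-modules. Moreover, $\{M^0,M^1,\dots,M^k\}=\{M^0\circ g,M^1\circ g,\dots,M^k\circ g\}$. (2) For any two strongly regular VOA structures $(U,Y_1(\cdot,z))$ and $(U,Y_2(\cdot,z))$ on $U=M^0\oplus M^1\oplus\cdots\oplus M^k$, there exists a VOA isomorphism $\Psi$ from $(U,Y_1(\cdot,z))$ to $(U,Y_2(\cdot,z))$ such that $\Psi|_V=\mathrm{id}$. Then there exists an automorphism $\tilde g$ of $U$ such that $\tilde g(V)=V$ and $\tilde g|_V=g$.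
   Context: VOA means vertex operator algebra. A VOA $V$ is strongly regular if it is simple, rational (every admissible module is a direct sum of irreducible admissible modules), $C_2$-cofinite (the span of all $u_{-2}v$, $u,v\in V$, has finite codimension in $V$) and of CFT-type ($V_0=\mathbb C\mathbf 1$, which implies $V_n=0$ for $n<0$). A VOA $U$ is called an extension vertex operator algebra of $V$ if $V$ is a vertex operator subalgebra of $U$ and $V$, $U$ have the same conformal element. For a $V$-module $M$ and $g\in\mathrm{Aut}(V)$, $M\circ g$ denotes the $V$-module which equals $M$ as a vector space and has vertex operators $Y_{M\circ g}(v,z)=Y_M(g(v),z)$. The equality of sets of modules in (1) is understood up to isomorphism of $V$-modules, and the VOA structures in (2) are structures on the given $V$-module $U$ making it an extension vertex operator algebra of $V$.
   Formalization: The extension vertex operator algebra U is itself assumed to be strongly regular; without this, condition (2) may hold vacuously (no strongly regular structure on U) and the claim can fail. *)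

theory Defs
  imports Complex_Main "HOL-Library.Function_Algebras" "HOL-Library.Groups_Big_Fun"
    "HOL-Library.Infinite_Typeclass"
begin

section \<open>Complex vector spaces\<close>

class complex_vector = ab_group_add +
  fixes scaleC :: "complex \<Rightarrow> 'a \<Rightarrow> 'a"  (infixr \<open>*\<^sub>C\<close> 75)
  assumes scaleC_add_right: "a *\<^sub>C (x + y) = a *\<^sub>C x + a *\<^sub>C y"
    and scaleC_add_left: "(a + b) *\<^sub>C x = a *\<^sub>C x + b *\<^sub>C x"
    and scaleC_scaleC: "a *\<^sub>C (b *\<^sub>C x) = (a * b) *\<^sub>C x"
    and scaleC_one: "1 *\<^sub>C x = x"

interpretation cvs: vector_space "scaleC :: complex \<Rightarrow> 'a \<Rightarrow> 'a::complex_vector"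
  by unfold_locales (simp_all add: scaleC_add_right scaleC_add_left scaleC_scaleC scaleC_one)

instantiation complex :: complex_vector
begin
definition scaleC_complex :: "complex \<Rightarrow> complex \<Rightarrow> complex"
  where "scaleC_complex a x = a * x"
instance by standard (simp_all add: scaleC_complex_def algebra_simps)
end

instantiation "fun" :: (type, complex_vector) complex_vector
begin
definition scaleC_fun :: "complex \<Rightarrow> ('a \<Rightarrow> 'b) \<Rightarrow> 'a \<Rightarrow> 'b"
  where "scaleC_fun a f = (\<lambda>x. a *\<^sub>C f x)"
instance
  by standard
    (simp_all add: scaleC_fun_def fun_eq_iff scaleC_add_right scaleC_add_left scaleC_scaleC
      scaleC_one)
end

definition clinear_on :: "'a::complex_vector set \<Rightarrow> ('a \<Rightarrow> 'b::complex_vector) \<Rightarrow> bool"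
  where "clinear_on S f \<longleftrightarrow>
    (\<forall>x\<in>S. \<forall>y\<in>S. f (x + y) = f x + f y) \<and> (\<forall>c. \<forall>x\<in>S. f (c *\<^sub>C x) = c *\<^sub>C f x)"

definition fin_dim :: "'a::complex_vector set \<Rightarrow> bool"
  where "fin_dim S \<longleftrightarrow> (\<exists>B. finite B \<and> S \<subseteq> cvs.span B)"

text \<open>\<open>A\<close> is the internal direct sum of the subspaces \<open>M i\<close>, \<open>i \<in> I\<close>; the index set may be
  infinite.\<close>

definition is_direct_sum :: "'a::complex_vector set \<Rightarrow> 'i set \<Rightarrow> ('i \<Rightarrow> 'a set) \<Rightarrow> bool"
  where "is_direct_sum A I M \<longleftrightarrow>
    (\<forall>i\<in>I. cvs.subspace (M i)) \<and>
    A = cvs.span (\<Union>i\<in>I. M i) \<and>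
    (\<forall>J f. finite J \<and> J \<subseteq> I \<and> (\<forall>i\<in>J. f i \<in> M i) \<and> (\<Sum>i\<in>J. f i) = 0 \<longrightarrow> (\<forall>i\<in>J. f i = 0))"


section \<open>Vertex operator algebras and weak modules\<close>

text \<open>A vertex operator \<open>Y(v,z) = \<Sum>n. v\<^sub>n z^(-n-1)\<close> is given by its modes: \<open>mode V v n w\<close> is
  \<open>v\<^sub>n w\<close>, and likewise \<open>action M v n w\<close> for a module. All spaces are subspaces of an ambient
  type, and nothing is assumed about the values of modes and maps outside of them.\<close>

record 'a voa =
  vspace :: "'a set"
  mode :: "'a \<Rightarrow> int \<Rightarrow> 'a \<Rightarrow> 'a"
  vac :: 'a
  conf :: 'a

record ('a, 'm) voa_mod =
  mspace :: "'m set"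
  action :: "'a \<Rightarrow> int \<Rightarrow> 'm \<Rightarrow> 'm"

definition adjoint_mod :: "'a voa \<Rightarrow> ('a, 'a) voa_mod"
  where "adjoint_mod V = \<lparr>mspace = vspace V, action = mode V\<rparr>"

text \<open>Jacobi identity: the coefficient of \<open>x\<^sub>0^(-l-1) x\<^sub>1^(-m-1) x\<^sub>2^(-n-1)\<close> in the usual
  delta-function form. By the truncation condition all three sums have finite support
  on the carriers, so \<open>Sum_any\<close> is the intended sum.\<close>

locale weak_module =
  fixes V :: "'a::complex_vector voa" and M :: "('a, 'm::complex_vector) voa_mod"
  assumes subspace_mspace: "cvs.subspace (mspace M)"
    and action_closed: "v \<in> vspace V \<Longrightarrow> w \<in> mspace M \<Longrightarrow> action M v n w \<in> mspace M"
    and action_linear_left: "w \<in> mspace M \<Longrightarrow> clinear_on (vspace V) (\<lambda>v. action M v n w)"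
    and action_linear_right: "v \<in> vspace V \<Longrightarrow> clinear_on (mspace M) (action M v n)"
    and truncation: "v \<in> vspace V \<Longrightarrow> w \<in> mspace M \<Longrightarrow> \<exists>N. \<forall>n\<ge>N. action M v n w = 0"
    and vacuum: "w \<in> mspace M \<Longrightarrow> action M (vac V) n w = (if n = -1 then w else 0)"
    and jacobi: "u \<in> vspace V \<Longrightarrow> v \<in> vspace V \<Longrightarrow> w \<in> mspace M \<Longrightarrow>
      Sum_any (\<lambda>i. (of_int m gchoose i) *\<^sub>C
        action M (mode V u (l + int i) v) (m + n - int i) w) =
      Sum_any (\<lambda>i. ((-1) ^ i * (of_int l gchoose i)) *\<^sub>C
        action M u (m + l - int i) (action M v (n + int i) w)) -
      Sum_any (\<lambda>i. ((-1) powi l * (-1) ^ i * (of_int l gchoose i)) *\<^sub>C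
        action M v (n + l - int i) (action M u (m + int i) w))"

definition L0_eigenspace ::
    "'a voa \<Rightarrow> ('a, 'm::complex_vector) voa_mod \<Rightarrow> complex \<Rightarrow> 'm set"
  where "L0_eigenspace V M a = {w \<in> mspace M. action M (conf V) 1 w = a *\<^sub>C w}"

definition weight_space :: "'a::complex_vector voa \<Rightarrow> int \<Rightarrow> 'a set"
  where "weight_space V n = L0_eigenspace V (adjoint_mod V) (of_int n)"

text \<open>With \<open>L(n) = \<omega>\<^sub>(n+1)\<close>. The grading is not a separate datum, since \<open>V\<^sub>n\<close> is the eigenspace of
  \<open>L(0)\<close> for \<open>n\<close>.\<close>

locale vertex_operator_algebra =
  fixes V :: "'a::complex_vector voa"
  assumes subspace_vspace: "cvs.subspace (vspace V)"
    and vac_in: "vac V \<in> vspace V"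
    and conf_in: "conf V \<in> vspace V"
    and adjoint: "weak_module V (adjoint_mod V)"
    and creation: "v \<in> vspace V \<Longrightarrow> mode V v (-1) (vac V) = v"
    and creation_regular: "v \<in> vspace V \<Longrightarrow> n \<ge> 0 \<Longrightarrow> mode V v n (vac V) = 0"
    and virasoro: "\<exists>c. \<forall>m n. \<forall>v\<in>vspace V.
      mode V (conf V) (m + 1) (mode V (conf V) (n + 1) v)
        - mode V (conf V) (n + 1) (mode V (conf V) (m + 1) v) =
      of_int (m - n) *\<^sub>C mode V (conf V) (m + n + 1) v
        + (if m + n = 0 then (of_int (m ^ 3 - m) / 12 * c) *\<^sub>C v else 0)"
    and L_minus1_derivative: "u \<in> vspace V \<Longrightarrow> v \<in> vspace V \<Longrightarrow>
      mode V (mode V (conf V) 0 u) n v = (- of_int n) *\<^sub>C mode V u (n - 1) v"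
    and grading: "is_direct_sum (vspace V) UNIV (weight_space V)"
    and weight_space_fin_dim: "fin_dim (weight_space V n)"
    and weight_space_bounded_below: "\<exists>N. \<forall>n<N. weight_space V n = {0}"


section \<open>Modules\<close>

definition submod :: "('a, 'm) voa_mod \<Rightarrow> 'm set \<Rightarrow> ('a, 'm) voa_mod"
  where "submod M N = M\<lparr>mspace := N\<rparr>"

definition twist :: "('a, 'm) voa_mod \<Rightarrow> ('a \<Rightarrow> 'a) \<Rightarrow> ('a, 'm) voa_mod"
  where "twist M g = M\<lparr>action := (\<lambda>v. action M (g v))\<rparr>"

definition is_submodule :: "'a voa \<Rightarrow> ('a, 'm::complex_vector) voa_mod \<Rightarrow> 'm set \<Rightarrow> bool"
  where "is_submodule V M N \<longleftrightarrow> cvs.subspace N \<and> N \<subseteq> mspace M \<and>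
    (\<forall>v\<in>vspace V. \<forall>n. \<forall>w\<in>N. action M v n w \<in> N)"

definition voa_module :: "'a::complex_vector voa \<Rightarrow> ('a, 'm::complex_vector) voa_mod \<Rightarrow> bool"
  where "voa_module V M \<longleftrightarrow> weak_module V M \<and>
    is_direct_sum (mspace M) UNIV (L0_eigenspace V M) \<and>
    (\<forall>a. fin_dim (L0_eigenspace V M a)) \<and>
    (\<forall>a. \<exists>N::int. \<forall>n<N. L0_eigenspace V M (a + of_int n) = {0})"

definition irreducible_module ::
    "'a::complex_vector voa \<Rightarrow> ('a, 'm::complex_vector) voa_mod \<Rightarrow> bool"
  where "irreducible_module V M \<longleftrightarrow> voa_module V M \<and> mspace M \<noteq> {0} \<and>
    (\<forall>N. is_submodule V M N \<longrightarrow> N = {0} \<or> N = mspace M)"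

definition mod_iso_map ::
    "'a voa \<Rightarrow> ('a, 'm::complex_vector) voa_mod \<Rightarrow> ('a, 'n::complex_vector) voa_mod
      \<Rightarrow> ('m \<Rightarrow> 'n) \<Rightarrow> bool"
  where "mod_iso_map V M N f \<longleftrightarrow>
    clinear_on (mspace M) f \<and> bij_betw f (mspace M) (mspace N) \<and>
    (\<forall>v\<in>vspace V. \<forall>n. \<forall>w\<in>mspace M. f (action M v n w) = action N v n (f w))"

definition mod_isomorphic ::
    "'a voa \<Rightarrow> ('a, 'm::complex_vector) voa_mod \<Rightarrow> ('a, 'n::complex_vector) voa_mod \<Rightarrow> bool"
  where "mod_isomorphic V M N \<longleftrightarrow> (\<exists>f. mod_iso_map V M N f)"

text \<open>An admissible module carries a grading by the natural numbers, \<open>gr n\<close> being its component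
  of degree \<open>n\<close>, with \<open>v\<^sub>m\<close> of degree \<open>wt v - m - 1\<close>.\<close>

definition admissible_module ::
    "'a::complex_vector voa \<Rightarrow> ('a, 'm::complex_vector) voa_mod \<Rightarrow> (nat \<Rightarrow> 'm set) \<Rightarrow> bool"
  where "admissible_module V M gr \<longleftrightarrow> weak_module V M \<and>
    is_direct_sum (mspace M) UNIV gr \<and>
    (\<forall>k m n. \<forall>v\<in>weight_space V k. \<forall>w\<in>gr n.
      action M v m w \<in> (let d = k - m - 1 + int n in if d \<ge> 0 then gr (nat d) else {0}))"

definition graded_submodule ::
    "'a::complex_vector voa \<Rightarrow> ('a, 'm::complex_vector) voa_mod \<Rightarrow> (nat \<Rightarrow> 'm set)
      \<Rightarrow> 'm set \<Rightarrow> bool"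
  where "graded_submodule V M gr N \<longleftrightarrow> is_submodule V M N \<and> is_direct_sum N UNIV (\<lambda>n. N \<inter> gr n)"

definition irreducible_admissible ::
    "'a::complex_vector voa \<Rightarrow> ('a, 'm::complex_vector) voa_mod \<Rightarrow> (nat \<Rightarrow> 'm set) \<Rightarrow> bool"
  where "irreducible_admissible V M gr \<longleftrightarrow> admissible_module V M gr \<and> mspace M \<noteq> {0} \<and>
    (\<forall>N. graded_submodule V M gr N \<longrightarrow> N = {0} \<or> N = mspace M)"


section \<open>Strong regularity\<close>

text \<open>Rationality speaks about all admissible modules, so a type has to be fixed in which they
  live: the subspaces of \<open>'x \<Rightarrow> complex\<close> for an arbitrary infinite type \<open>'x\<close>. Up to isomorphism
  these are all the spaces of dimension at most the dimension of \<open>'x \<Rightarrow> complex\<close>, in particular all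
  spaces of countable dimension. For a vertex operator algebra the notion does not depend on
  \<open>'x\<close>: an admissible module of any size is the sum of its submodules generated by one homogeneous
  vector, these have countable dimension, and a sum of irreducible submodules is a direct sum of
  some of them.\<close>

definition voa_rational :: "'x::infinite itself \<Rightarrow> 'a::complex_vector voa \<Rightarrow> bool"
  where "voa_rational X V \<longleftrightarrow>
    (\<forall>(M :: ('a, 'x \<Rightarrow> complex) voa_mod) gr. admissible_module V M gr \<longrightarrow>
      (\<exists>S. (\<forall>N\<in>S. graded_submodule V M gr N \<and>
              irreducible_admissible V (submod M N) (\<lambda>n. N \<inter> gr n)) \<and>
           is_direct_sum (mspace M) S (\<lambda>N. N)))"

definition voa_simple :: "'a::complex_vector voa \<Rightarrow> bool"
  where "voa_simple V \<longleftrightarrow> vspace V \<noteq> {0} \<and>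
    (\<forall>I. is_submodule V (adjoint_mod V) I \<longrightarrow> I = {0} \<or> I = vspace V)"

definition C2_cofinite :: "'a::complex_vector voa \<Rightarrow> bool"
  where "C2_cofinite V \<longleftrightarrow> (\<exists>B. finite B \<and> B \<subseteq> vspace V \<and>
    vspace V = cvs.span (B \<union> {mode V u (-2) v | u v. u \<in> vspace V \<and> v \<in> vspace V}))"

definition CFT_type :: "'a::complex_vector voa \<Rightarrow> bool"
  where "CFT_type V \<longleftrightarrow> weight_space V 0 = cvs.span {vac V}"

definition strongly_regular :: "'x::infinite itself \<Rightarrow> 'a::complex_vector voa \<Rightarrow> bool"
  where "strongly_regular X V \<longleftrightarrow> vertex_operator_algebra V \<and>
    voa_simple V \<and> voa_rational X V \<and> C2_cofinite V \<and> CFT_type V"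


section \<open>Isomorphisms and extensions\<close>

definition voa_isomorphism ::
    "'a::complex_vector voa \<Rightarrow> 'b::complex_vector voa \<Rightarrow> ('a \<Rightarrow> 'b) \<Rightarrow> bool"
  where "voa_isomorphism V W f \<longleftrightarrow>
    clinear_on (vspace V) f \<and> bij_betw f (vspace V) (vspace W) \<and>
    (\<forall>u\<in>vspace V. \<forall>n. \<forall>v\<in>vspace V. f (mode V u n v) = mode W (f u) n (f v)) \<and>
    f (vac V) = vac W \<and> f (conf V) = conf W"

definition voa_automorphism :: "'a::complex_vector voa \<Rightarrow> ('a \<Rightarrow> 'a) \<Rightarrow> bool"
  where "voa_automorphism V f \<longleftrightarrow> voa_isomorphism V V f"

definition extension_voa :: "'a::complex_vector voa \<Rightarrow> 'a voa \<Rightarrow> bool"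
  where "extension_voa V U \<longleftrightarrow> vertex_operator_algebra V \<and> vertex_operator_algebra U \<and>
    vspace V \<subseteq> vspace U \<and>
    (\<forall>u\<in>vspace V. \<forall>n. \<forall>v\<in>vspace V. mode V u n v = mode U u n v) \<and>
    vac V = vac U \<and> conf V = conf U"

text \<open>\<open>W\<close> is another extension of \<open>V\<close> on the space of \<open>U\<close> that induces the same \<open>V\<close>-module
  structure on it.\<close>

definition extension_structure_on ::
    "'a::complex_vector voa \<Rightarrow> 'a voa \<Rightarrow> 'a voa \<Rightarrow> bool"
  where "extension_structure_on V U W \<longleftrightarrow> extension_voa V W \<and> vspace W = vspace U \<and>
    (\<forall>v\<in>vspace V. \<forall>n. \<forall>u\<in>vspace U. mode W v n u = mode U v n u)"

end

theory Submission
  imports Defs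
begin

text \<open>The idea is to compare the extension \<open>U\<close> with the extension obtained from it by relabelling
  along \<open>g\<close>. Twisting by \<open>g\<close> permutes the summands \<open>M\<^sup>i\<close> up to isomorphism, because
  they are finitely many and pairwise nonisomorphic, and so isomorphisms between a summand and the
  twist of another one glue to an isomorphism of \<open>V\<close>-modules \<open>f : U \<circ> g \<rightarrow> U\<close>. On the
  summand \<open>V\<close> one can take \<open>f = g\<^sup>-\<^sup>1\<close>, which is an isomorphism \<open>V \<circ> g \<rightarrow> V\<close>
  (\<open>twist_iso_extending_inverse\<close>).

  Transporting the algebra structure of \<open>U\<close> along \<open>f\<close> gives a second structure
  \<open>Y\<^sub>f(u, z) = f Y(f\<^sup>-\<^sup>1 u, z) f\<^sup>-\<^sup>1\<close> on the same space. For \<open>v\<close> in \<open>V\<close> it is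
  \<open>f Y(g v, z) f\<^sup>-\<^sup>1 = Y(v, z)\<close> since \<open>f\<close> is a module map on the twist, so the new structure
  extends \<open>V\<close> and induces the old \<open>V\<close>-module structure (\<open>extension_structure_on_transport\<close>). It is
  strongly regular because \<open>f\<close> is an isomorphism onto it (\<open>strongly_regular_target\<close>).
  Uniqueness of extension structures now gives an isomorphism \<open>\<Psi>\<close> from the old structure to the new one
  that is the identity on \<open>V\<close>. Then \<open>f\<^sup>-\<^sup>1 \<circ> \<Psi>\<close> is an automorphism of \<open>U\<close>, and on \<open>V\<close> it
  equals \<open>f\<^sup>-\<^sup>1 = g\<close>.

  The longest part is the invariance of strong regularity under isomorphisms. Algebras and modules
  are carried by subspaces, with no information outside of them, so every axiom has to be pulled back
  element by element.\<close>


section \<open>Linear maps on subspaces\<close>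

lemma clinear_on_add: "clinear_on S f \<Longrightarrow> x \<in> S \<Longrightarrow> y \<in> S \<Longrightarrow> f (x + y) = f x + f y"
  by (simp add: clinear_on_def)

lemma clinear_on_scale: "clinear_on S f \<Longrightarrow> x \<in> S \<Longrightarrow> f (c *\<^sub>C x) = c *\<^sub>C f x"
  by (simp add: clinear_on_def)

lemma clinear_on_zero: "clinear_on S f \<Longrightarrow> cvs.subspace S \<Longrightarrow> f 0 = 0"
  using clinear_on_scale[of S f 0 0] cvs.subspace_0[of S] by simp

lemma clinear_on_diff:
  assumes "clinear_on S f" "cvs.subspace S" "x \<in> S" "y \<in> S"
  shows "f (x - y) = f x - f y"
  using clinear_on_add[OF assms(1), of "x - y" y] cvs.subspace_diff[OF assms(2-4)] assms(4)
  by (simp add: algebra_simps)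

lemma clinear_on_sum:
  assumes "clinear_on S f" "cvs.subspace S" "\<And>i. i \<in> I \<Longrightarrow> h i \<in> S"
  shows "f (\<Sum>i\<in>I. h i) = (\<Sum>i\<in>I. f (h i))"
  using assms(3)
proof (induction I rule: infinite_finite_induct)
  case (insert i I)
  then have "(\<Sum>j\<in>I. h j) \<in> S" by (intro cvs.subspace_sum assms(2)) auto
  with insert show ?case by (simp add: clinear_on_add[OF assms(1)])
qed (simp_all add: clinear_on_zero[OF assms(1,2)])

lemma clinear_on_comp:
  "clinear_on S f \<Longrightarrow> f ` S \<subseteq> T \<Longrightarrow> clinear_on T h \<Longrightarrow> clinear_on S (h \<circ> f)"
  by (auto simp: clinear_on_def image_subset_iff)

lemma clinear_on_inv_into:
  assumes f: "clinear_on S f" "bij_betw f S T" and S: "cvs.subspace S"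
  shows "clinear_on T (inv_into S f)"
proof -
  have inj: "inj_on f S" and T: "T = f ` S" using f(2) by (auto simp: bij_betw_def)
  have "inv_into S f (f x + f y) = x + y" if "x \<in> S" "y \<in> S" for x y
    using that inv_into_f_f[OF inj, of "x + y"]
    by (simp add: clinear_on_add[OF f(1)] cvs.subspace_add[OF S])
  moreover have "inv_into S f (c *\<^sub>C f x) = c *\<^sub>C x" if "x \<in> S" for c x
    using that inv_into_f_f[OF inj, of "c *\<^sub>C x"]
    by (simp add: clinear_on_scale[OF f(1)] cvs.subspace_scale[OF S])
  ultimately show ?thesis
    by (auto simp: clinear_on_def T inv_into_f_f[OF inj])
qed

lemma clinear_on_inj_onI:
  assumes "clinear_on S f" "cvs.subspace S" "\<And>x. x \<in> S \<Longrightarrow> f x = 0 \<Longrightarrow> x = 0"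
  shows "inj_on f S"
proof (rule inj_onI)
  fix x y assume "x \<in> S" "y \<in> S" "f x = f y"
  then have "x - y = 0"
    by (intro assms(3)) (auto simp: clinear_on_diff[OF assms(1,2)] cvs.subspace_diff[OF assms(2)])
  then show "x = y" by simp
qed

lemma inj_on_clinear_eq_0_iff:
  assumes "clinear_on S f" "cvs.subspace S" "inj_on f S" "x \<in> S"
  shows "f x = 0 \<longleftrightarrow> x = 0"
  using inj_onD[OF assms(3) _ assms(4) cvs.subspace_0[OF assms(2)]] clinear_on_zero[OF assms(1,2)]
  by auto

lemma subspace_image_clinear_on:
  assumes f: "clinear_on S f" and S: "cvs.subspace S" and N: "cvs.subspace N" "N \<subseteq> S"
  shows "cvs.subspace (f ` N)"
proof (rule cvs.subspaceI)
  show "0 \<in> f ` N"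
    using clinear_on_zero[OF f S] cvs.subspace_0[OF N(1)] by (metis image_eqI)
next
  fix x y assume "x \<in> f ` N" "y \<in> f ` N"
  then obtain a b where ab: "a \<in> N" "b \<in> N" "x = f a" "y = f b" by blast
  then have "x + y = f (a + b)" using N(2) clinear_on_add[OF f, of a b, symmetric] by (simp add: subset_iff)
  with ab show "x + y \<in> f ` N" using cvs.subspace_add[OF N(1)] by blast
next
  fix c x assume "x \<in> f ` N"
  then obtain a where a: "a \<in> N" "x = f a" by blast
  then have "c *\<^sub>C x = f (c *\<^sub>C a)" using N(2) clinear_on_scale[OF f, of a c, symmetric] by (simp add: subset_iff)
  with a show "c *\<^sub>C x \<in> f ` N" using cvs.subspace_scale[OF N(1)] by blast
qed

lemma image_span_clinear_on:
  assumes f: "clinear_on S f" and S: "cvs.subspace S" and B: "B \<subseteq> S"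
  shows "f ` cvs.span B = cvs.span (f ` B)"
proof
  have sub: "cvs.span B \<subseteq> S" using cvs.span_minimal[OF B S] .
  show "cvs.span (f ` B) \<subseteq> f ` cvs.span B"
    by (rule cvs.span_minimal[OF _ subspace_image_clinear_on[OF f S cvs.subspace_span sub]])
      (auto intro: cvs.span_base)
  have "x \<in> S \<and> f x \<in> cvs.span (f ` B)" if "x \<in> cvs.span B" for x
    using that
  proof (induction rule: cvs.span_induct_alt)
    case base
    then show ?case
      using clinear_on_zero[OF f S] cvs.subspace_0[OF S] by (simp add: cvs.span_zero)
  next
    case (step c x y)
    have x: "x \<in> S" using step B by blast
    then have cx: "c *\<^sub>C x \<in> S" by (rule cvs.subspace_scale[OF S])
    have "f (c *\<^sub>C x + y) = c *\<^sub>C f x + f y"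
      using x cx step by (simp add: clinear_on_add[OF f] clinear_on_scale[OF f])
    with step x cx show ?case
      by (simp add: cvs.subspace_add[OF S] cvs.span_add cvs.span_scale cvs.span_base)
  qed
  then show "f ` cvs.span B \<subseteq> cvs.span (f ` B)" by blast
qed

lemma fin_dim_image:
  assumes f: "clinear_on S f" and S: "cvs.subspace S" and N: "cvs.subspace N" "N \<subseteq> S" "fin_dim N"
  shows "fin_dim (f ` N)"
proof -
  obtain B where B: "finite B" "N \<subseteq> cvs.span B" using N(3) by (auto simp: fin_dim_def)
  \<comment> \<open>The spanning set may leave the domain of linearity, so it is replaced by a basis
    of the subspace itself, which is finite by the exchange lemma.\<close>
  obtain C where C: "C \<subseteq> N" "cvs.independent C" "N \<subseteq> cvs.span C"
    using cvs.maximal_independent_subset[of N] by blast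
  have "finite C" using cvs.independent_span_bound[OF B(1) C(2)] C(1) B(2) by blast
  moreover have "f ` N \<subseteq> cvs.span (f ` C)"
    using image_span_clinear_on[OF f S, of C] C N(2) by blast
  ultimately show ?thesis unfolding fin_dim_def by blast
qed

text \<open>An injective linear map preserves and reflects whether a summand vanishes, so both
  sums have the same support: either both are finite, or both have the default value 0.\<close>

lemma clinear_on_Sum_any:
  assumes f: "clinear_on S f" "inj_on f S" and S: "cvs.subspace S" and h: "\<And>i. h i \<in> S"
  shows "Sum_any (\<lambda>i. f (h i)) = f (Sum_any h)"
  using clinear_on_sum[OF f(1) S, where h = h] h
  by (simp add: Sum_any.expand_set inj_on_clinear_eq_0_iff[OF f(1) S f(2)])

lemma subspace_Sum_any: "cvs.subspace S \<Longrightarrow> (\<And>i. h i \<in> S) \<Longrightarrow> Sum_any h \<in> S"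
  by (simp add: Sum_any.expand_set cvs.subspace_sum)


section \<open>Direct sums\<close>

lemma direct_sum_subspace: "is_direct_sum A I M \<Longrightarrow> i \<in> I \<Longrightarrow> cvs.subspace (M i)"
  by (simp add: is_direct_sum_def)

lemma direct_sum_subset: "is_direct_sum A I M \<Longrightarrow> i \<in> I \<Longrightarrow> M i \<subseteq> A"
  by (auto simp: is_direct_sum_def intro: cvs.span_base)

lemma direct_sum_zeroD:
  "is_direct_sum A I M \<Longrightarrow> finite J \<Longrightarrow> J \<subseteq> I \<Longrightarrow> (\<And>i. i \<in> J \<Longrightarrow> h i \<in> M i) \<Longrightarrow>
    (\<Sum>i\<in>J. h i) = 0 \<Longrightarrow> i \<in> J \<Longrightarrow> h i = 0"
  unfolding is_direct_sum_def by blast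

lemma is_direct_sumI:
  assumes "\<And>i. i \<in> I \<Longrightarrow> cvs.subspace (M i)" "A = cvs.span (\<Union>i\<in>I. M i)"
    and zero: "\<And>J h i. finite J \<Longrightarrow> J \<subseteq> I \<Longrightarrow> (\<And>i. i \<in> J \<Longrightarrow> h i \<in> M i) \<Longrightarrow>
      (\<Sum>i\<in>J. h i) = 0 \<Longrightarrow> i \<in> J \<Longrightarrow> h i = 0"
  shows "is_direct_sum A I M"
  unfolding is_direct_sum_def
proof (intro conjI allI impI ballI)
  fix J h i
  assume "finite J \<and> J \<subseteq> I \<and> (\<forall>i\<in>J. h i \<in> M i) \<and> (\<Sum>i\<in>J. h i) = 0" "i \<in> J"
  then show "h i = 0" by (intro zero[of J h i]) auto
qed (use assms in auto)

lemma direct_sum_image: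
  assumes f: "clinear_on A f" "inj_on f A" and M: "is_direct_sum A I M"
  shows "is_direct_sum (f ` A) I (\<lambda>i. f ` M i)"
proof -
  have A: "cvs.subspace A" using M cvs.subspace_span by (simp add: is_direct_sum_def)
  have sub: "M i \<subseteq> A" if "i \<in> I" for i using direct_sum_subset[OF M that] .
  show ?thesis
  proof (rule is_direct_sumI)
    show "cvs.subspace (f ` M i)" if "i \<in> I" for i
      using M that by (intro subspace_image_clinear_on[OF f(1) A] sub) (auto simp: is_direct_sum_def)
    show "f ` A = cvs.span (\<Union>i\<in>I. f ` M i)"
      using M image_span_clinear_on[OF f(1) A, of "\<Union>i\<in>I. M i"] sub
      by (auto simp: is_direct_sum_def image_UN)
    fix J h i
    assume J: "finite J" "J \<subseteq> I" and h: "\<And>i. i \<in> J \<Longrightarrow> h i \<in> f ` M i"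
      and 0: "(\<Sum>i\<in>J. h i) = 0" and i: "i \<in> J"
    have "\<forall>i\<in>J. \<exists>x\<in>M i. h i = f x" using h by blast
    then obtain x where x: "\<And>i. i \<in> J \<Longrightarrow> x i \<in> M i" "\<And>i. i \<in> J \<Longrightarrow> h i = f (x i)" by metis
    have xA: "x i \<in> A" if "i \<in> J" for i using x(1)[OF that] sub J(2) that by blast
    have "f (\<Sum>i\<in>J. x i) = 0"
      using 0 x(2) clinear_on_sum[OF f(1) A, of J x] xA by simp
    then have "(\<Sum>i\<in>J. x i) = 0"
      using inj_on_clinear_eq_0_iff[OF f(1) A f(2) cvs.subspace_sum[OF A, of J x]] xA by simp
    then have "x i = 0" using direct_sum_zeroD[OF M J x(1)] i by blast
    then show "h i = 0" using x(2)[OF i] clinear_on_zero[OF f(1) A] by simp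
  qed
qed

lemma direct_sum_reindex:
  assumes M: "is_direct_sum A J M" and s: "bij_betw s I J"
  shows "is_direct_sum A I (\<lambda>i. M (s i))"
proof -
  have J: "J = s ` I" and inj: "inj_on s I" using s by (auto simp: bij_betw_def)
  show ?thesis
  proof (rule is_direct_sumI)
    show "cvs.subspace (M (s i))" if "i \<in> I" for i
      using M that by (auto simp: is_direct_sum_def J)
    show "A = cvs.span (\<Union>i\<in>I. M (s i))"
      using M by (simp add: is_direct_sum_def J)
    fix K h i
    assume K: "finite K" "K \<subseteq> I" and h: "\<And>i. i \<in> K \<Longrightarrow> h i \<in> M (s i)"
      and 0: "(\<Sum>i\<in>K. h i) = 0" and i: "i \<in> K"
    have inv: "inv_into I s (s i) = i" if "i \<in> K" for i
      using that K(2) inj by (simp add: subset_iff)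
    have "(\<Sum>j\<in>s ` K. h (inv_into I s j)) = (\<Sum>i\<in>K. h i)"
      using sum.reindex[OF inj_on_subset[OF inj K(2)], of "\<lambda>j. h (inv_into I s j)"] inv
      by simp
    moreover have "h (inv_into I s j) \<in> M j" if "j \<in> s ` K" for j using that h inv by auto
    moreover have "finite (s ` K)" "s ` K \<subseteq> J" using K J by auto
    ultimately have "h (inv_into I s (s i)) = 0"
      using 0 i by (intro direct_sum_zeroD[OF M, of "s ` K" "\<lambda>j. h (inv_into I s j)"]) auto
    then show "h i = 0" using i inv by simp
  qed
qed

lemma direct_sum_decompose:
  assumes M: "is_direct_sum A I M" "finite I" and x: "x \<in> A"
  obtains h where "\<And>i. i \<in> I \<Longrightarrow> h i \<in> M i" "x = (\<Sum>i\<in>I. h i)"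
proof -
  have sp: "cvs.subspace (M i)" if "i \<in> I" for i using M that by (simp add: is_direct_sum_def)
  have "x \<in> cvs.span (\<Union>i\<in>I. M i)" using M(1) x by (simp add: is_direct_sum_def)
  then have "\<exists>h. (\<forall>i\<in>I. h i \<in> M i) \<and> x = (\<Sum>i\<in>I. h i)"
  proof (induction rule: cvs.span_induct_alt)
    case base
    then show ?case using sp by (intro exI[of _ "\<lambda>_. 0"]) (auto intro: cvs.subspace_0)
  next
    case (step c y z)
    then obtain h j where h: "\<forall>i\<in>I. h i \<in> M i" "z = (\<Sum>i\<in>I. h i)" and j: "j \<in> I" "y \<in> M j"
      by blast
    let ?h = "\<lambda>i. (if i = j then c *\<^sub>C y else 0) + h i"
    have "\<forall>i\<in>I. ?h i \<in> M i" using h(1) j sp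
      by (auto intro!: cvs.subspace_add cvs.subspace_scale)
    moreover have "(\<Sum>i\<in>I. ?h i) = c *\<^sub>C y + z"
      using h(2) j(1) M(2) by (simp add: sum.distrib)
    ultimately show ?case by (intro exI[of _ ?h]) simp
  qed
  then show thesis using that by blast
qed

lemma direct_sum_unique:
  assumes M: "is_direct_sum A I M" "finite I"
    and h: "\<And>i. i \<in> I \<Longrightarrow> h i \<in> M i" "\<And>i. i \<in> I \<Longrightarrow> h' i \<in> M i"
    and eq: "(\<Sum>i\<in>I. h i) = (\<Sum>i\<in>I. h' i)" and i: "i \<in> I"
  shows "h i = h' i"
proof -
  have "(\<Sum>i\<in>I. h i - h' i) = 0" using eq by (simp add: sum_subtractf)
  moreover have "h i - h' i \<in> M i" if "i \<in> I" for i
    using M(1) h[OF that] that by (auto simp: is_direct_sum_def intro: cvs.subspace_diff)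
  ultimately have "h i - h' i = 0"
    using i by (intro direct_sum_zeroD[OF M subset_refl, of "\<lambda>i. h i - h' i"]) auto
  then show ?thesis by simp
qed

text \<open>A vector is sent to the sum of the images of its components. The directness of both sums is
  used: in the source the components are unique, which makes the map linear, and in the target
  a vanishing sum of images has vanishing terms, which makes it injective.\<close>

lemma direct_sum_map:
  assumes M: "is_direct_sum A I M" "finite I"
    and N: "is_direct_sum B I N"
    and h: "\<And>i. i \<in> I \<Longrightarrow> clinear_on (M i) (h i)" "\<And>i. i \<in> I \<Longrightarrow> bij_betw (h i) (M i) (N i)"
  obtains f where "clinear_on A f" "bij_betw f A B" "\<And>i x. i \<in> I \<Longrightarrow> x \<in> M i \<Longrightarrow> f x = h i x"
proof -
  have sp: "cvs.subspace (M i)" if "i \<in> I" for i using M that by (simp add: is_direct_sum_def)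
  have spA: "cvs.subspace A" and spB: "cvs.subspace B"
    using M(1) N cvs.subspace_span by (simp_all add: is_direct_sum_def)
  have hN: "h i x \<in> N i" if "i \<in> I" "x \<in> M i" for i x
    using h(2)[OF that(1)] that(2) by (auto simp: bij_betw_def)
  have h0: "h i 0 = 0" if "i \<in> I" for i using clinear_on_zero[OF h(1) sp] that by blast
  have "\<forall>x\<in>A. \<exists>p. (\<forall>i\<in>I. p i \<in> M i) \<and> x = (\<Sum>i\<in>I. p i)"
    using direct_sum_decompose[OF M] by metis
  then obtain p where p: "\<And>x i. x \<in> A \<Longrightarrow> i \<in> I \<Longrightarrow> p x i \<in> M i" "\<And>x. x \<in> A \<Longrightarrow> x = (\<Sum>i\<in>I. p x i)"
    by metis
  define f where "f x = (\<Sum>i\<in>I. h i (p x i))" for x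
  have f: "f (\<Sum>i\<in>I. x i) = (\<Sum>i\<in>I. h i (x i))" if x: "\<And>i. i \<in> I \<Longrightarrow> x i \<in> M i" for x
  proof -
    have "x i \<in> A" if "i \<in> I" for i using x[OF that] direct_sum_subset[OF M(1) that] by blast
    then have "(\<Sum>i\<in>I. x i) \<in> A" by (rule cvs.subspace_sum[OF spA])
    then have "p (\<Sum>i\<in>I. x i) i = x i" if "i \<in> I" for i
      using p that by (intro direct_sum_unique[OF M _ x]) metis+
    then show ?thesis by (simp add: f_def)
  qed
  have lin: "clinear_on A f"
    unfolding clinear_on_def
  proof (intro conjI ballI allI)
    fix x y assume xy: "x \<in> A" "y \<in> A"
    have "x + y = (\<Sum>i\<in>I. p x i + p y i)"
      using p(2)[OF xy(1)] p(2)[OF xy(2)] by (simp add: sum.distrib)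
    then have "f (x + y) = (\<Sum>i\<in>I. h i (p x i + p y i))"
      using f[of "\<lambda>i. p x i + p y i"] p(1) xy sp by (simp add: cvs.subspace_add)
    also have "\<dots> = (\<Sum>i\<in>I. h i (p x i) + h i (p y i))"
      using p(1) xy by (intro sum.cong refl clinear_on_add[OF h(1)]) auto
    also have "\<dots> = f x + f y" by (simp add: f_def sum.distrib)
    finally show "f (x + y) = f x + f y" .
  next
    fix c x assume x: "x \<in> A"
    have "c *\<^sub>C x = (\<Sum>i\<in>I. c *\<^sub>C p x i)"
      using p(2)[OF x] by (metis cvs.scale_sum_right)
    then have "f (c *\<^sub>C x) = (\<Sum>i\<in>I. h i (c *\<^sub>C p x i))"
      using f[of "\<lambda>i. c *\<^sub>C p x i"] p(1) x sp by (simp add: cvs.subspace_scale)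
    also have "\<dots> = (\<Sum>i\<in>I. c *\<^sub>C h i (p x i))"
      using p(1) x by (intro sum.cong refl clinear_on_scale[OF h(1)]) auto
    also have "\<dots> = c *\<^sub>C f x" by (simp add: f_def cvs.scale_sum_right)
    finally show "f (c *\<^sub>C x) = c *\<^sub>C f x" .
  qed
  have ext: "f x = h i x" if i: "i \<in> I" and x: "x \<in> M i" for i x
  proof -
    have "f (\<Sum>j\<in>I. if j = i then x else 0) = (\<Sum>j\<in>I. h j (if j = i then x else 0))"
      using x sp by (intro f) (auto intro: cvs.subspace_0)
    also have "\<dots> = (\<Sum>j\<in>I. if j = i then h i x else 0)"
      by (intro sum.cong) (auto simp: h0)
    finally show ?thesis using i M(2) by simp
  qed
  have "inj_on f A"
  proof (rule clinear_on_inj_onI[OF lin spA])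
    fix x assume x: "x \<in> A" and "f x = 0"
    then have "(\<Sum>i\<in>I. h i (p x i)) = (\<Sum>i\<in>I. h i 0)" by (simp add: f_def h0)
    then have "h i (p x i) = h i 0" if "i \<in> I" for i
      using that p(1)[OF x] sp cvs.subspace_0
      by (intro direct_sum_unique[OF N M(2), of "\<lambda>i. h i (p x i)" "\<lambda>i. h i 0"] hN) auto
    then have "p x i = 0" if "i \<in> I" for i
      using that p(1)[OF x that] h(2)[OF that] cvs.subspace_0[OF sp[OF that]]
      unfolding bij_betw_def by (metis inj_onD)
    then show "x = 0" using p(2)[OF x] by simp
  qed
  moreover have "f ` A \<subseteq> B"
    using p(1) hN direct_sum_subset[OF N] by (force simp: f_def intro!: cvs.subspace_sum[OF spB])
  moreover have "B \<subseteq> f ` A"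
  proof
    fix y assume "y \<in> B"
    then obtain q where q: "\<And>i. i \<in> I \<Longrightarrow> q i \<in> N i" "y = (\<Sum>i\<in>I. q i)"
      using direct_sum_decompose[OF N M(2)] by metis
    have "\<forall>i\<in>I. \<exists>x\<in>M i. h i x = q i" using q(1) h(2) by (metis bij_betw_imp_surj_on imageE)
    then obtain x where x: "\<And>i. i \<in> I \<Longrightarrow> x i \<in> M i" "\<And>i. i \<in> I \<Longrightarrow> h i (x i) = q i" by metis
    have "y = f (\<Sum>i\<in>I. x i)" using f[OF x(1)] x(2) q(2) by simp
    moreover have "(\<Sum>i\<in>I. x i) \<in> A"
      using x(1) direct_sum_subset[OF M(1)] by (intro cvs.subspace_sum[OF spA]) blast
    ultimately show "y \<in> f ` A" by blast
  qed
  ultimately have "bij_betw f A B" by (auto simp: bij_betw_def)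
  from that[OF lin this ext] show thesis .
qed


section \<open>Isomorphisms of modules\<close>

lemma mod_iso_map_comp:
  "mod_iso_map V M N f \<Longrightarrow> mod_iso_map V N K h \<Longrightarrow> mod_iso_map V M K (h \<circ> f)"
  unfolding mod_iso_map_def
  by (auto intro: bij_betw_trans clinear_on_comp simp: bij_betw_imp_surj_on bij_betw_apply)

lemma mod_iso_map_inv_into:
  assumes f: "mod_iso_map V M N f" and M: "cvs.subspace (mspace M)"
    and closed: "\<And>v n w. v \<in> vspace V \<Longrightarrow> w \<in> mspace M \<Longrightarrow> action M v n w \<in> mspace M"
  shows "mod_iso_map V N M (inv_into (mspace M) f)"
proof -
  have bij: "bij_betw f (mspace M) (mspace N)" and lin: "clinear_on (mspace M) f"
    and act: "\<And>v n w. v \<in> vspace V \<Longrightarrow> w \<in> mspace M \<Longrightarrow> f (action M v n w) = action N v n (f w)"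
    using f by (auto simp: mod_iso_map_def)
  have "inv_into (mspace M) f (action N v n y) = action M v n (inv_into (mspace M) f y)"
    if v: "v \<in> vspace V" and y: "y \<in> mspace N" for v n y
  proof -
    obtain x where x: "x \<in> mspace M" "y = f x" using y bij by (auto simp: bij_betw_def)
    show ?thesis
      unfolding x(2) act[OF v x(1), symmetric]
      using bij x(1) closed[OF v x(1)] by (simp add: bij_betw_inv_into_left)
  qed
  then show ?thesis
    using clinear_on_inv_into[OF lin bij M] bij_betw_inv_into[OF bij] by (simp add: mod_iso_map_def)
qed

text \<open>Since \<open>g\<close> is onto, commuting with the actions of all \<open>g v\<close> is commuting with the action of every
  vector.\<close>

lemma mod_iso_map_untwist:
  assumes f: "mod_iso_map V (twist M g) (twist N g) f" and g: "g ` vspace V = vspace V"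
  shows "mod_iso_map V M N f"
proof -
  have "f (action M v n w) = action N v n (f w)" if v: "v \<in> vspace V" and w: "w \<in> mspace M" for v n w
  proof -
    obtain u where "u \<in> vspace V" "v = g u" using v g by blast
    then show ?thesis using f w by (simp add: mod_iso_map_def twist_def)
  qed
  then show ?thesis using f by (simp add: mod_iso_map_def twist_def)
qed

text \<open>The summands are submodules, so acting on a vector means acting on its components, and gluing
  module maps yields a module map.\<close>

lemma direct_sum_mod_iso:
  assumes A: "is_direct_sum (mspace K) I A" "finite I"
    and B: "is_direct_sum (mspace L) I B"
    and h: "\<And>i. i \<in> I \<Longrightarrow> mod_iso_map V (submod K (A i)) (submod L (B i)) (h i)"
    and closed: "\<And>i v n w. i \<in> I \<Longrightarrow> v \<in> vspace V \<Longrightarrow> w \<in> A i \<Longrightarrow> action K v n w \<in> A i"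
    and K: "\<And>v n. v \<in> vspace V \<Longrightarrow> clinear_on (mspace K) (action K v n)"
    and L: "\<And>v n. v \<in> vspace V \<Longrightarrow> clinear_on (mspace L) (action L v n)"
  obtains f where "mod_iso_map V K L f" "\<And>i x. i \<in> I \<Longrightarrow> x \<in> A i \<Longrightarrow> f x = h i x"
proof -
  have spK: "cvs.subspace (mspace K)" and spL: "cvs.subspace (mspace L)"
    using A(1) B cvs.subspace_span by (simp_all add: is_direct_sum_def)
  obtain f where f: "clinear_on (mspace K) f" "bij_betw f (mspace K) (mspace L)"
    and ext: "\<And>i x. i \<in> I \<Longrightarrow> x \<in> A i \<Longrightarrow> f x = h i x"
    using direct_sum_map[OF A B, of h] h by (auto simp: mod_iso_map_def submod_def)
  have fL: "f x \<in> mspace L" if "x \<in> mspace K" for x using f(2) that by (auto simp: bij_betw_def)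
  have "f (action K v n w) = action L v n (f w)" if v: "v \<in> vspace V" and w: "w \<in> mspace K" for v n w
  proof -
    obtain x where x: "\<And>i. i \<in> I \<Longrightarrow> x i \<in> A i" "w = (\<Sum>i\<in>I. x i)"
      using direct_sum_decompose[OF A w] by metis
    have xK: "x i \<in> mspace K" if "i \<in> I" for i
      using x(1)[OF that] direct_sum_subset[OF A(1) that] by blast
    have aK: "action K v n (x i) \<in> mspace K" if "i \<in> I" for i
      using closed[OF that v x(1)[OF that]] direct_sum_subset[OF A(1) that] by blast
    have "f (action K v n w) = (\<Sum>i\<in>I. f (action K v n (x i)))"
      unfolding x(2) using xK aK
      by (simp add: clinear_on_sum[OF K[OF v] spK] clinear_on_sum[OF f(1) spK])
    also have "\<dots> = (\<Sum>i\<in>I. action L v n (f (x i)))"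
      using h x(1) v closed
      by (intro sum.cong refl) (simp add: ext mod_iso_map_def submod_def)
    also have "\<dots> = action L v n (f w)"
      unfolding x(2) using xK fL
      by (simp add: clinear_on_sum[OF L[OF v] spL] clinear_on_sum[OF f(1) spK])
    finally show ?thesis .
  qed
  with f have "mod_iso_map V K L f" by (simp add: mod_iso_map_def)
  from that[OF this ext] show thesis .
qed


section \<open>Strong regularity is invariant under isomorphism\<close>

lemma voa_isomorphism_comp:
  "voa_isomorphism U V f \<Longrightarrow> voa_isomorphism V W h \<Longrightarrow> voa_isomorphism U W (h \<circ> f)"
  unfolding voa_isomorphism_def
  by (auto intro: bij_betw_trans clinear_on_comp simp: bij_betw_imp_surj_on bij_betw_apply)

text \<open>This is \<open>twist\<close> for maps between two algebras that may live in different types.\<close>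

definition pullback_mod :: "('a \<Rightarrow> 'b) \<Rightarrow> ('b, 'm) voa_mod \<Rightarrow> ('a, 'm) voa_mod"
  where "pullback_mod f M = \<lparr>mspace = mspace M, action = (\<lambda>v. action M (f v))\<rparr>"

locale voa_iso = vertex_operator_algebra V
  for V :: "'a::complex_vector voa" +
  fixes W :: "'b::complex_vector voa" and f :: "'a \<Rightarrow> 'b"
  assumes iso: "voa_isomorphism V W f"
begin

lemma lin: "clinear_on (vspace V) f"
  and bij: "bij_betw f (vspace V) (vspace W)"
  and map_mode: "u \<in> vspace V \<Longrightarrow> v \<in> vspace V \<Longrightarrow> f (mode V u n v) = mode W (f u) n (f v)"
  and map_vac: "f (vac V) = vac W"
  and map_conf: "f (conf V) = conf W"
  using iso by (auto simp: voa_isomorphism_def)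

lemma inj: "inj_on f (vspace V)" and image: "f ` vspace V = vspace W"
  using bij by (auto simp: bij_betw_def)

lemma map_zero: "f 0 = 0"
  using clinear_on_zero[OF lin subspace_vspace] .

lemma in_W[simp]: "v \<in> vspace V \<Longrightarrow> f v \<in> vspace W"
  using image by blast

lemma W_cases: assumes "w \<in> vspace W" obtains v where "v \<in> vspace V" "w = f v"
  using assms image by blast

sublocale adj: weak_module V "adjoint_mod V"
  by (rule adjoint)

lemma mode_closed: "u \<in> vspace V \<Longrightarrow> v \<in> vspace V \<Longrightarrow> mode V u n v \<in> vspace V"
  using adj.action_closed by (simp add: adjoint_mod_def)

lemmas V_closed = mode_closed conf_in vac_in cvs.subspace_add[OF subspace_vspace]
  cvs.subspace_diff[OF subspace_vspace] cvs.subspace_scale[OF subspace_vspace]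
  cvs.subspace_0[OF subspace_vspace] subspace_Sum_any[OF subspace_vspace]

text \<open>Read from left to right, these rules pull the isomorphism out of an expression in the
  target, so that an axiom there becomes the image of the same axiom in the source.\<close>

lemmas pull = map_mode[symmetric] map_vac[symmetric] map_conf[symmetric]
  clinear_on_add[OF lin, symmetric] clinear_on_diff[OF lin subspace_vspace, symmetric]
  clinear_on_scale[OF lin, symmetric] clinear_on_Sum_any[OF lin inj subspace_vspace]

lemma eq_iff: "x \<in> vspace V \<Longrightarrow> y \<in> vspace V \<Longrightarrow> f x = f y \<longleftrightarrow> x = y"
  using inj by (auto dest: inj_onD)

lemma voa_isomorphism_inv: "voa_isomorphism W V (inv_into (vspace V) f)"
proof -
  have inv: "inv_into (vspace V) f (f x) = x" if "x \<in> vspace V" for x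
    using inv_into_f_f[OF inj that] .
  have "inv_into (vspace V) f (mode W u n v) =
      mode V (inv_into (vspace V) f u) n (inv_into (vspace V) f v)"
    if "u \<in> vspace W" "v \<in> vspace W" for u n v
    using that by (elim W_cases) (simp add: pull inv V_closed)
  then show ?thesis
    using clinear_on_inv_into[OF lin bij subspace_vspace] bij_betw_inv_into[OF bij]
    by (simp add: voa_isomorphism_def pull inv V_closed)
qed

lemma weak_module_target: "weak_module W (adjoint_mod W)"
proof
  have linL: "clinear_on (vspace V) (\<lambda>v. mode V v n w)" if "w \<in> vspace V" for n w
    using adj.action_linear_left that by (simp add: adjoint_mod_def)
  show "cvs.subspace (mspace (adjoint_mod W))"
    using subspace_image_clinear_on[OF lin subspace_vspace subspace_vspace]
    by (simp add: adjoint_mod_def image)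
  fix v w n assume w: "w \<in> mspace (adjoint_mod W)"
  show "action (adjoint_mod W) (vac W) n w = (if n = - 1 then w else 0)"
    using w adj.vacuum
    by (auto simp: adjoint_mod_def map_zero pull V_closed elim!: W_cases)
  show "clinear_on (vspace W) (\<lambda>v. action (adjoint_mod W) v n w)"
    using w unfolding clinear_on_def
    by (auto simp: adjoint_mod_def pull V_closed clinear_on_add[OF linL] clinear_on_scale[OF linL]
        elim!: W_cases)
  assume v: "v \<in> vspace W"
  show "action (adjoint_mod W) v n w \<in> mspace (adjoint_mod W)"
    using v w by (auto simp: adjoint_mod_def pull V_closed elim!: W_cases)
  show "\<exists>N. \<forall>n\<ge>N. action (adjoint_mod W) v n w = 0"
  proof -
    obtain v' w' where vw: "v' \<in> vspace V" "w' \<in> vspace V" "v = f v'" "w = f w'"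
      using v w by (auto simp: adjoint_mod_def elim!: W_cases)
    then obtain N where "\<forall>n\<ge>N. mode V v' n w' = 0"
      using adj.truncation[of v' w'] by (auto simp: adjoint_mod_def)
    with vw show ?thesis
      by (intro exI[of _ N]) (simp add: adjoint_mod_def pull map_zero)
  qed
next
  have linR: "clinear_on (vspace V) (mode V v n)" if "v \<in> vspace V" for n v
    using adj.action_linear_right that by (simp add: adjoint_mod_def)
  fix v n assume v: "v \<in> vspace W"
  then show "clinear_on (mspace (adjoint_mod W)) (action (adjoint_mod W) v n)"
    unfolding clinear_on_def
    by (auto simp: adjoint_mod_def pull V_closed clinear_on_add[OF linR] clinear_on_scale[OF linR]
        elim!: W_cases)
next
  fix u v w m l n
  assume "u \<in> vspace W" "v \<in> vspace W" "w \<in> mspace (adjoint_mod W)"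
  then obtain u' v' w' where "u' \<in> vspace V" "v' \<in> vspace V" "w' \<in> vspace V"
    "u = f u'" "v = f v'" "w = f w'"
    by (auto simp: adjoint_mod_def elim!: W_cases)
  then show "Sum_any (\<lambda>i. (of_int m gchoose i) *\<^sub>C
        action (adjoint_mod W) (mode W u (l + int i) v) (m + n - int i) w) =
      Sum_any (\<lambda>i. ((-1) ^ i * (of_int l gchoose i)) *\<^sub>C
        action (adjoint_mod W) u (m + l - int i) (action (adjoint_mod W) v (n + int i) w)) -
      Sum_any (\<lambda>i. ((-1) powi l * (-1) ^ i * (of_int l gchoose i)) *\<^sub>C
        action (adjoint_mod W) v (n + l - int i) (action (adjoint_mod W) u (m + int i) w))"
    using adj.jacobi[of u' v' w' m l n] by (simp add: adjoint_mod_def pull V_closed)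
qed

lemma weight_space_target: "weight_space W n = f ` weight_space V n"
  unfolding weight_space_def L0_eigenspace_def adjoint_mod_def
  by (auto simp: pull V_closed eq_iff elim!: W_cases)

lemma weight_space_subset: "weight_space V n \<subseteq> vspace V"
  by (auto simp: weight_space_def L0_eigenspace_def adjoint_mod_def)

lemma subspace_weight_space: "cvs.subspace (weight_space V n)"
  using grading by (simp add: is_direct_sum_def)

lemma vertex_operator_algebra_target: "vertex_operator_algebra W"
proof (rule vertex_operator_algebra.intro)
  show "cvs.subspace (vspace W)"
    using subspace_image_clinear_on[OF lin subspace_vspace subspace_vspace] by (simp add: image)
  show "vac W \<in> vspace W" "conf W \<in> vspace W"
    by (simp_all add: pull V_closed)
  show "weak_module W (adjoint_mod W)" by (rule weak_module_target)
  show "mode W v (-1) (vac W) = v" if "v \<in> vspace W" for v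
    using that by (elim W_cases) (simp add: pull V_closed creation)
  show "mode W v n (vac W) = 0" if "v \<in> vspace W" "n \<ge> 0" for v n
    using that by (elim W_cases) (simp add: pull V_closed creation_regular map_zero)
  obtain c where c: "\<forall>m n. \<forall>v\<in>vspace V.
      mode V (conf V) (m + 1) (mode V (conf V) (n + 1) v)
        - mode V (conf V) (n + 1) (mode V (conf V) (m + 1) v) =
      of_int (m - n) *\<^sub>C mode V (conf V) (m + n + 1) v
        + (if m + n = 0 then (of_int (m ^ 3 - m) / 12 * c) *\<^sub>C v else 0)"
    using virasoro by blast
  have if_pull: "(if P then f x else 0) = f (if P then x else 0)" for P x by (simp add: map_zero)
  have if_closed: "(if P then x else 0) \<in> vspace V" if "x \<in> vspace V" for P x
    using that V_closed by simp
  show "\<exists>c. \<forall>m n. \<forall>v\<in>vspace W.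
      mode W (conf W) (m + 1) (mode W (conf W) (n + 1) v)
        - mode W (conf W) (n + 1) (mode W (conf W) (m + 1) v) =
      of_int (m - n) *\<^sub>C mode W (conf W) (m + n + 1) v
        + (if m + n = 0 then (of_int (m ^ 3 - m) / 12 * c) *\<^sub>C v else 0)"
  proof (intro exI[of _ c] allI ballI, elim W_cases)
    fix m n w v assume "v \<in> vspace V" "w = f v"
    then show "mode W (conf W) (m + 1) (mode W (conf W) (n + 1) w)
        - mode W (conf W) (n + 1) (mode W (conf W) (m + 1) w) =
      of_int (m - n) *\<^sub>C mode W (conf W) (m + n + 1) w
        + (if m + n = 0 then (of_int (m ^ 3 - m) / 12 * c) *\<^sub>C w else 0)"
      using c by (simp only: pull V_closed if_pull if_closed)
  qed
  show "mode W (mode W (conf W) 0 u) n v = (- of_int n) *\<^sub>C mode W u (n - 1) v"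
    if "u \<in> vspace W" "v \<in> vspace W" for u v n
    using that by (elim W_cases) (simp only: pull V_closed L_minus1_derivative)
  show "is_direct_sum (vspace W) UNIV (weight_space W)"
    using direct_sum_image[OF lin inj grading] by (simp add: image weight_space_target[abs_def])
  show "fin_dim (weight_space W n)" for n
    unfolding weight_space_target
    by (rule fin_dim_image[OF lin subspace_vspace subspace_weight_space weight_space_subset
          weight_space_fin_dim])
  show "\<exists>N. \<forall>n<N. weight_space W n = {0}"
  proof -
    obtain N where "\<forall>n<N. weight_space V n = {0}" using weight_space_bounded_below by blast
    then show ?thesis by (intro exI[of _ N]) (simp add: weight_space_target map_zero)
  qed
qed

lemma voa_simple_target:
  assumes "voa_simple V"
  shows "voa_simple W"
  unfolding voa_simple_def
proof (intro conjI allI impI)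
  show "vspace W \<noteq> {0}"
    using assms inj_on_clinear_eq_0_iff[OF lin subspace_vspace inj] V_closed(7)
    by (auto simp: voa_simple_def image[symmetric])
  fix I assume I: "is_submodule W (adjoint_mod W) I"
  let ?J = "{v \<in> vspace V. f v \<in> I}"
  have I': "cvs.subspace I" "I \<subseteq> vspace W"
    and ideal: "\<And>v n w. v \<in> vspace W \<Longrightarrow> w \<in> I \<Longrightarrow> mode W v n w \<in> I"
    using I by (auto simp: is_submodule_def adjoint_mod_def)
  have "cvs.subspace ?J"
    using I'(1) V_closed
    by (auto intro!: cvs.subspaceI simp: map_zero clinear_on_add[OF lin] clinear_on_scale[OF lin]
        cvs.subspace_0 cvs.subspace_add cvs.subspace_scale)
  then have "is_submodule V (adjoint_mod V) ?J"
    by (auto simp: is_submodule_def adjoint_mod_def V_closed map_mode ideal)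
  then have "?J = {0} \<or> ?J = vspace V" using assms unfolding voa_simple_def by blast
  moreover have "f ` ?J = vspace W \<inter> I" unfolding image[symmetric] by auto
  then have "f ` ?J = I" using I'(2) by blast
  ultimately show "I = {0} \<or> I = vspace W"
    using image by (elim disjE) (simp_all add: map_zero)
qed

lemma C2_cofinite_target:
  assumes "C2_cofinite V"
  shows "C2_cofinite W"
proof -
  let ?C = "{mode V u (-2) v | u v. u \<in> vspace V \<and> v \<in> vspace V}"
  obtain B where B: "finite B" "B \<subseteq> vspace V" "vspace V = cvs.span (B \<union> ?C)"
    using assms by (auto simp: C2_cofinite_def)
  have C: "f ` ?C = {mode W u (-2) v | u v. u \<in> vspace W \<and> v \<in> vspace W}" (is "_ = ?D")
  proof
    show "f ` ?C \<subseteq> ?D" using map_mode in_W by blast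
    show "?D \<subseteq> f ` ?C"
    proof
      fix y assume "y \<in> ?D"
      then obtain u v where "u \<in> vspace V" "v \<in> vspace V" "y = mode W (f u) (-2) (f v)"
        by (auto elim!: W_cases)
      then show "y \<in> f ` ?C"
        by (intro image_eqI[of _ _ "mode V u (-2) v"]) (auto simp: map_mode)
    qed
  qed
  have "B \<union> ?C \<subseteq> vspace V" using B(2) mode_closed by blast
  then have "f ` cvs.span (B \<union> ?C) = cvs.span (f ` B \<union> f ` ?C)"
    using image_span_clinear_on[OF lin subspace_vspace] by (simp only: image_Un)
  then have "vspace W = cvs.span (f ` B \<union> ?D)"
    by (simp only: C B(3)[symmetric] image)
  moreover have "finite (f ` B)" "f ` B \<subseteq> vspace W" using B(1,2) image by auto
  ultimately show ?thesis unfolding C2_cofinite_def by blast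
qed

lemma CFT_type_target: "CFT_type V \<Longrightarrow> CFT_type W"
  using image_span_clinear_on[OF lin subspace_vspace, of "{vac V}"] vac_in
  by (simp add: CFT_type_def weight_space_target map_vac)

text \<open>Modules of the target become modules of the source by pulling back the action along the
  isomorphism, with the same underlying space, gradings and submodules. Conversely, every property
  of a module only concerns the actions of vectors of the algebra, and these are all images.\<close>

lemma weak_module_pullback_iff: "weak_module V (pullback_mod f M) \<longleftrightarrow> weak_module W M"
proof
  assume "weak_module W M"
  then interpret M: weak_module W M .
  show "weak_module V (pullback_mod f M)"
  proof
    fix n w assume w: "w \<in> mspace (pullback_mod f M)"
    then have "clinear_on (vspace V) ((\<lambda>v. action M v n w) \<circ> f)"
      by (intro clinear_on_comp[OF lin _ M.action_linear_left]) (auto simp: pullback_mod_def)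
    then show "clinear_on (vspace V) (\<lambda>v. action (pullback_mod f M) v n w)"
      by (simp add: comp_def pullback_mod_def)
  next
    fix u v w m l n
    assume "u \<in> vspace V" "v \<in> vspace V" "w \<in> mspace (pullback_mod f M)"
    then show "Sum_any (\<lambda>i. (of_int m gchoose i) *\<^sub>C
        action (pullback_mod f M) (mode V u (l + int i) v) (m + n - int i) w) =
      Sum_any (\<lambda>i. ((-1) ^ i * (of_int l gchoose i)) *\<^sub>C
        action (pullback_mod f M) u (m + l - int i) (action (pullback_mod f M) v (n + int i) w)) -
      Sum_any (\<lambda>i. ((-1) powi l * (-1) ^ i * (of_int l gchoose i)) *\<^sub>C
        action (pullback_mod f M) v (n + l - int i) (action (pullback_mod f M) u (m + int i) w))"
      using M.jacobi[of "f u" "f v" w m l n] by (simp add: pullback_mod_def map_mode)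
  qed (auto simp: pullback_mod_def M.subspace_mspace M.action_closed M.action_linear_right M.truncation
      M.vacuum map_vac)
next
  assume "weak_module V (pullback_mod f M)"
  then interpret M: weak_module V "pullback_mod f M" .
  show "weak_module W M"
  proof
    show "cvs.subspace (mspace M)"
      using M.subspace_mspace by (simp add: pullback_mod_def)
    fix n w assume w: "w \<in> mspace M"
    have linL: "clinear_on (vspace V) (\<lambda>v. action M (f v) n w)"
      using M.action_linear_left w by (simp add: pullback_mod_def)
    show "clinear_on (vspace W) (\<lambda>v. action M v n w)"
      unfolding clinear_on_def
      by (auto simp: pull V_closed clinear_on_add[OF linL] clinear_on_scale[OF linL]
          elim!: W_cases)
    show "action M (vac W) n w = (if n = -1 then w else 0)"
      using M.vacuum w by (simp add: pullback_mod_def map_vac)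
  next
    fix u v w m l n
    assume "u \<in> vspace W" "v \<in> vspace W" "w \<in> mspace M"
    then obtain u' v' where "u' \<in> vspace V" "v' \<in> vspace V" "u = f u'" "v = f v'"
      by (auto elim!: W_cases)
    then show "Sum_any (\<lambda>i. (of_int m gchoose i) *\<^sub>C
        action M (mode W u (l + int i) v) (m + n - int i) w) =
      Sum_any (\<lambda>i. ((-1) ^ i * (of_int l gchoose i)) *\<^sub>C
        action M u (m + l - int i) (action M v (n + int i) w)) -
      Sum_any (\<lambda>i. ((-1) powi l * (-1) ^ i * (of_int l gchoose i)) *\<^sub>C
        action M v (n + l - int i) (action M u (m + int i) w))"
      using M.jacobi[of u' v' w m l n] \<open>w \<in> mspace M\<close> by (simp add: pullback_mod_def pull)
  next
    fix v w n assume "v \<in> vspace W"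
    then obtain v' where "v' \<in> vspace V" "v = f v'" by (rule W_cases)
    then show "clinear_on (mspace M) (action M v n)"
      and "w \<in> mspace M \<Longrightarrow> action M v n w \<in> mspace M"
      and "w \<in> mspace M \<Longrightarrow> \<exists>N. \<forall>n\<ge>N. action M v n w = 0"
      using M.action_linear_right M.action_closed M.truncation by (simp_all add: pullback_mod_def)
  qed
qed

lemma admissible_module_pullback_iff: "admissible_module V (pullback_mod f M) gr \<longleftrightarrow> admissible_module W M gr"
  unfolding admissible_module_def weak_module_pullback_iff
  by (simp add: pullback_mod_def weight_space_target)

lemma graded_submodule_pullback_iff:
  "graded_submodule V (pullback_mod f M) gr N \<longleftrightarrow> graded_submodule W M gr N"
  by (simp add: graded_submodule_def is_submodule_def pullback_mod_def image[symmetric])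

lemma irreducible_admissible_pullback_iff:
  "irreducible_admissible V (pullback_mod f M) gr \<longleftrightarrow> irreducible_admissible W M gr"
  unfolding irreducible_admissible_def admissible_module_pullback_iff graded_submodule_pullback_iff
  by (simp add: pullback_mod_def)

lemma voa_rational_target:
  assumes "voa_rational TYPE('x::infinite) V"
  shows "voa_rational TYPE('x) W"
  unfolding voa_rational_def
proof (intro allI impI)
  fix M :: "('b, 'x \<Rightarrow> complex) voa_mod" and gr
  assume "admissible_module W M gr"
  then obtain S where S: "is_direct_sum (mspace (pullback_mod f M)) S (\<lambda>N. N)"
    "\<And>N. N \<in> S \<Longrightarrow> graded_submodule V (pullback_mod f M) gr N"
    "\<And>N. N \<in> S \<Longrightarrow> irreducible_admissible V (submod (pullback_mod f M) N) (\<lambda>n. N \<inter> gr n)"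
    using assms unfolding voa_rational_def admissible_module_pullback_iff[symmetric] by meson
  have "submod (pullback_mod f M) N = pullback_mod f (submod M N)" for N
    by (simp add: submod_def pullback_mod_def)
  then have "irreducible_admissible W (submod M N) (\<lambda>n. N \<inter> gr n)" if "N \<in> S" for N
    using S(3)[OF that] by (simp only: irreducible_admissible_pullback_iff)
  moreover have "graded_submodule W M gr N" if "N \<in> S" for N
    using S(2)[OF that] by (simp only: graded_submodule_pullback_iff)
  moreover have "is_direct_sum (mspace M) S (\<lambda>N. N)"
    using S(1) by (simp add: pullback_mod_def)
  ultimately show "\<exists>S. (\<forall>N\<in>S. graded_submodule W M gr N \<and>
            irreducible_admissible W (submod M N) (\<lambda>n. N \<inter> gr n)) \<and>
         is_direct_sum (mspace M) S (\<lambda>N. N)"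
    by blast
qed

lemma strongly_regular_target:
  "strongly_regular TYPE('x::infinite) V \<Longrightarrow> strongly_regular TYPE('x) W"
  by (simp add: strongly_regular_def vertex_operator_algebra_target voa_simple_target
      voa_rational_target C2_cofinite_target CFT_type_target)

end


section \<open>Lifting automorphisms\<close>

definition transport_voa :: "('a \<Rightarrow> 'b) \<Rightarrow> 'a voa \<Rightarrow> 'b voa"
  where "transport_voa f U =
    \<lparr>vspace = f ` vspace U,
     mode = (\<lambda>a n b. f (mode U (inv_into (vspace U) f a) n (inv_into (vspace U) f b))),
     vac = f (vac U), conf = f (conf U)\<rparr>"

lemma voa_isomorphism_transport:
  "clinear_on (vspace U) f \<Longrightarrow> inj_on f (vspace U) \<Longrightarrow> voa_isomorphism U (transport_voa f U) f"
  by (simp add: voa_isomorphism_def transport_voa_def bij_betw_def)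

text \<open>That \<open>f\<close> is a module map from the twist means \<open>f (Y(g v, z) f\<^sup>-\<^sup>1(u)) = Y(v, z) u\<close>. If \<open>f\<close> is
  inverse to \<open>g\<close> on the subalgebra, the left-hand side is the transported vertex operator of \<open>v\<close>.\<close>

lemma extension_structure_on_transport:
  assumes U: "extension_voa V U" and g: "voa_automorphism V g"
    and f: "mod_iso_map V (twist (adjoint_mod U) g) (adjoint_mod U) f"
    and fg: "\<And>v. v \<in> vspace V \<Longrightarrow> f (g v) = v"
  shows "extension_structure_on V U (transport_voa f U)"
proof -
  have ext: "vertex_operator_algebra V" "vertex_operator_algebra U" "vspace V \<subseteq> vspace U"
    "\<And>u n v. u \<in> vspace V \<Longrightarrow> v \<in> vspace V \<Longrightarrow> mode V u n v = mode U u n v"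
    "vac V = vac U" "conf V = conf U"
    using U by (auto simp: extension_voa_def)
  have lin: "clinear_on (vspace U) f" and bij: "bij_betw f (vspace U) (vspace U)"
    and act: "\<And>v n w. v \<in> vspace V \<Longrightarrow> w \<in> vspace U \<Longrightarrow> f (mode U (g v) n w) = mode U v n (f w)"
    using f by (auto simp: mod_iso_map_def adjoint_mod_def twist_def)
  have inj: "inj_on f (vspace U)" and image: "f ` vspace U = vspace U"
    using bij by (auto simp: bij_betw_def)
  have gV: "g v \<in> vspace V" if "v \<in> vspace V" for v
    using g that by (auto simp: voa_automorphism_def voa_isomorphism_def bij_betw_def)
  have g_fix: "g (vac V) = vac V" "g (conf V) = conf V"
    using g by (auto simp: voa_automorphism_def voa_isomorphism_def)
  have V_in: "vac V \<in> vspace V" "conf V \<in> vspace V"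
    using ext(1) by (auto simp: vertex_operator_algebra_def)
  interpret W: voa_iso U "transport_voa f U" f
    using ext(2) voa_isomorphism_transport[OF lin inj] by (simp add: voa_iso_def voa_iso_axioms_def)
  have inv: "inv_into (vspace U) f v = g v" if "v \<in> vspace V" for v
    using inv_into_f_f[OF inj, of "g v"] fg[OF that] gV[OF that] ext(3) by auto
  have mode: "mode (transport_voa f U) v n u = mode U v n u"
    if v: "v \<in> vspace V" and u: "u \<in> vspace U" for v n u
  proof -
    have "inv_into (vspace U) f u \<in> vspace U" "f (inv_into (vspace U) f u) = u"
      using u image by (auto intro: inv_into_into f_inv_into_f)
    then show ?thesis
      using act[OF v, of "inv_into (vspace U) f u" n] inv[OF v] by (simp add: transport_voa_def)
  qed
  have "f (vac V) = vac V" "f (conf V) = conf V"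
    using fg[OF V_in(1)] fg[OF V_in(2)] by (simp_all add: g_fix)
  then have "vac (transport_voa f U) = vac V" "conf (transport_voa f U) = conf V"
    by (simp_all add: transport_voa_def ext(5,6))
  moreover have "vspace (transport_voa f U) = vspace U"
    by (simp add: transport_voa_def image)
  moreover have "mode V u n v = mode (transport_voa f U) u n v"
    if "u \<in> vspace V" "v \<in> vspace V" for u n v
    using that ext(3) ext(4)[OF that] mode[of u v n] by auto
  ultimately show ?thesis
    using ext(1,3) mode W.vertex_operator_algebra_target
    by (simp add: extension_structure_on_def extension_voa_def)
qed

text \<open>The homomorphism property \<open>g(Y(v, z) x) = Y(g v, z) g x\<close>, read backwards, says that \<open>g\<^sup>-\<^sup>1\<close>
  intertwines the twisted action with the original one.\<close>

lemma mod_iso_map_inv_automorphism: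
  assumes U: "extension_voa V U" and g: "voa_automorphism V g"
  shows "mod_iso_map V (twist (submod (adjoint_mod U) (vspace V)) g)
    (submod (adjoint_mod U) (vspace V)) (inv_into (vspace V) g)"
proof -
  interpret G: voa_iso V V g
    using U g by (simp add: voa_iso_def voa_iso_axioms_def extension_voa_def voa_automorphism_def)
  have "inv_into (vspace V) g (mode U (g v) n w) = mode U v n (inv_into (vspace V) g w)"
    if v: "v \<in> vspace V" and w: "w \<in> vspace V" for v n w
  proof -
    obtain x where x: "x \<in> vspace V" "w = g x" using w by (rule G.W_cases)
    have "inv_into (vspace V) g (mode V (g v) n w) = inv_into (vspace V) g (g (mode V v n x))"
      by (simp add: x G.map_mode v)
    also have "\<dots> = mode V v n (inv_into (vspace V) g w)"
      using x v by (simp add: inv_into_f_f[OF G.inj] G.mode_closed)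
    finally have "inv_into (vspace V) g (mode V (g v) n w) = mode V v n (inv_into (vspace V) g w)" .
    moreover have "inv_into (vspace V) g w \<in> vspace V"
      using x by (simp add: inv_into_f_f[OF G.inj])
    ultimately show ?thesis using U v w G.in_W[OF v] by (simp add: extension_voa_def)
  qed
  then show ?thesis
    using clinear_on_inv_into[OF G.lin G.bij G.subspace_vspace] bij_betw_inv_into[OF G.bij]
    by (simp add: mod_iso_map_def twist_def submod_def adjoint_mod_def)
qed

text \<open>If \<open>M\<^sup>i\<close> and \<open>M\<^sup>j\<close> have isomorphic twists, they are isomorphic, so sending each summand to
  its twist is injective on the finitely many summands. A twist is therefore again a sum of the
  same pairwise nonisomorphic modules, and isomorphisms between the summands can be glued.\<close>

lemma twist_iso_extending_inverse:
  fixes M :: "nat \<Rightarrow> 'u::complex_vector set" and k :: nat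
  assumes g: "voa_automorphism V g" and U: "extension_voa V U"
    and decomposition: "M 0 = vspace V" "is_direct_sum (vspace U) {0..k} M"
    and closed: "\<And>i v n w. i \<le> k \<Longrightarrow> v \<in> vspace V \<Longrightarrow> w \<in> M i \<Longrightarrow> mode U v n w \<in> M i"
    and nonisomorphic: "\<And>i j. i \<le> k \<Longrightarrow> j \<le> k \<Longrightarrow> i \<noteq> j \<Longrightarrow>
      \<not> mod_isomorphic V (submod (adjoint_mod U) (M i)) (submod (adjoint_mod U) (M j))"
    and twist_in: "\<And>i. i \<le> k \<Longrightarrow> \<exists>j\<le>k.
      mod_isomorphic V (twist (submod (adjoint_mod U) (M i)) g) (submod (adjoint_mod U) (M j))"
  obtains f where "mod_iso_map V (twist (adjoint_mod U) g) (adjoint_mod U) f"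
    "\<And>v. v \<in> vspace V \<Longrightarrow> f (g v) = v"
proof -
  let ?K = "\<lambda>i. submod (adjoint_mod U) (M i)"
  interpret U: weak_module U "adjoint_mod U"
    using U by (simp add: extension_voa_def vertex_operator_algebra_def)
  have VU: "vspace V \<subseteq> vspace U" using U by (simp add: extension_voa_def)
  have g_bij: "bij_betw g (vspace V) (vspace V)"
    using g by (simp add: voa_automorphism_def voa_isomorphism_def)
  then have gV: "g ` vspace V = vspace V" by (simp add: bij_betw_def)
  then have gv: "g v \<in> vspace V" if "v \<in> vspace V" for v
    using that by blast
  have sp: "cvs.subspace (M i)" if "i \<le> k" for i
    using direct_sum_subspace[OF decomposition(2)] that by simp
  \<comment> \<open>On \<open>M\<^sup>0 = V\<close> the isomorphism is prescribed, since an arbitrary one need not be inverse to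
    \<open>g\<close>.\<close>
  have "\<forall>i\<in>{0..k}. \<exists>j h. j \<in> {0..k} \<and> mod_iso_map V (twist (?K i) g) (?K j) h \<and>
      (i = 0 \<longrightarrow> h = inv_into (vspace V) g)"
  proof
    fix i assume i: "i \<in> {0..k}"
    show "\<exists>j h. j \<in> {0..k} \<and> mod_iso_map V (twist (?K i) g) (?K j) h \<and>
      (i = 0 \<longrightarrow> h = inv_into (vspace V) g)"
    proof (cases "i = 0")
      case True
      then show ?thesis
        using mod_iso_map_inv_automorphism[OF U g] decomposition(1)
        by (intro exI[of _ 0] exI[of _ "inv_into (vspace V) g"]) simp
    next
      case False
      then show ?thesis using twist_in[of i] i by (auto simp: mod_isomorphic_def)
    qed
  qed
  then obtain s h where s: "\<And>i. i \<in> {0..k} \<Longrightarrow> s i \<in> {0..k}"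
    and h: "\<And>i. i \<in> {0..k} \<Longrightarrow> mod_iso_map V (twist (?K i) g) (?K (s i)) (h i)"
    and h0: "h 0 = inv_into (vspace V) g"
    by (metis atLeastAtMost_iff le0)
  have "inj_on s {0..k}"
  proof (rule inj_onI, rule ccontr)
    fix i j assume ij: "i \<in> {0..k}" "j \<in> {0..k}" "s i = s j" "i \<noteq> j"
    have "mod_iso_map V (?K (s j)) (twist (?K j) g) (inv_into (M j) (h j))"
      using mod_iso_map_inv_into[OF h[OF ij(2)]] sp[of j] ij(2) closed[of j] gv
      by (simp add: twist_def submod_def adjoint_mod_def)
    from mod_iso_map_comp[OF h[OF ij(1), unfolded ij(3)] this]
    have "mod_isomorphic V (?K i) (?K j)"
      using mod_iso_map_untwist[OF _ gV] by (auto simp: mod_isomorphic_def)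
    with nonisomorphic[of i j] ij show False by simp
  qed
  moreover have "s ` {0..k} \<subseteq> {0..k}" using s by blast
  ultimately have "bij_betw s {0..k} {0..k}"
    using endo_inj_surj[of "{0..k}" s] by (simp add: bij_betw_def)
  note target = direct_sum_reindex[OF decomposition(2) this]
  have lin: "clinear_on (vspace U) (mode U v n)" if "v \<in> vspace V" for v n
    using U.action_linear_right that VU by (auto simp: adjoint_mod_def)
  have twist_submod: "submod (twist (adjoint_mod U) g) (M i) = twist (?K i) g" for i
    by (simp add: submod_def twist_def)
  obtain f where f: "mod_iso_map V (twist (adjoint_mod U) g) (adjoint_mod U) f"
    and ext: "\<And>i x. i \<in> {0..k} \<Longrightarrow> x \<in> M i \<Longrightarrow> f x = h i x"
  proof (rule direct_sum_mod_iso[of "twist (adjoint_mod U) g" "{0..k}" M "adjoint_mod U"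
        "\<lambda>i. M (s i)" V h])
    show "is_direct_sum (mspace (twist (adjoint_mod U) g)) {0..k} M"
      "is_direct_sum (mspace (adjoint_mod U)) {0..k} (\<lambda>i. M (s i))"
      using decomposition(2) target by (simp_all add: twist_def adjoint_mod_def)
    show "mod_iso_map V (submod (twist (adjoint_mod U) g) (M i)) (?K (s i)) (h i)"
      if "i \<in> {0..k}" for i using h[OF that] by (simp add: twist_submod)
    show "action (twist (adjoint_mod U) g) v n w \<in> M i"
      if "i \<in> {0..k}" "v \<in> vspace V" "w \<in> M i" for i v n w
      using that closed gv by (auto simp: twist_def adjoint_mod_def)
    show "clinear_on (mspace (twist (adjoint_mod U) g)) (action (twist (adjoint_mod U) g) v n)"
      if "v \<in> vspace V" for v n
      using lin[OF gv[OF that]] by (simp add: twist_def adjoint_mod_def)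
    show "clinear_on (mspace (adjoint_mod U)) (action (adjoint_mod U) v n)"
      if "v \<in> vspace V" for v n
      using that lin by (simp add: adjoint_mod_def)
  qed simp_all
  have "f (g v) = v" if v: "v \<in> vspace V" for v
    using ext[of 0 "g v"] gv[OF v] decomposition(1) h0 bij_betw_inv_into_left[OF g_bij v] by simp
  from that[OF f this] show thesis .
qed

theorem theorem3p7:
  fixes V U :: "'u::complex_vector voa"
    and g :: "'u \<Rightarrow> 'u"
    and M :: "nat \<Rightarrow> 'u set"
    and k :: nat
  assumes V: "strongly_regular TYPE('x::infinite) V"
    and g: "voa_automorphism V g"
    and U: "extension_voa V U" "strongly_regular TYPE('x) U"
    and decomposition: "M 0 = vspace V" "is_direct_sum (vspace U) {0..k} M"
    and irreducible: "\<And>i. i \<le> k \<Longrightarrow> irreducible_module V (submod (adjoint_mod U) (M i))"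
    and nonisomorphic: "\<And>i j. i \<le> k \<Longrightarrow> j \<le> k \<Longrightarrow> i \<noteq> j \<Longrightarrow>
      \<not> mod_isomorphic V (submod (adjoint_mod U) (M i)) (submod (adjoint_mod U) (M j))"
    and twist_in: "\<And>i. i \<le> k \<Longrightarrow> \<exists>j\<le>k.
      mod_isomorphic V (twist (submod (adjoint_mod U) (M i)) g) (submod (adjoint_mod U) (M j))"
    and in_twist: "\<And>j. j \<le> k \<Longrightarrow> \<exists>i\<le>k.
      mod_isomorphic V (submod (adjoint_mod U) (M j)) (twist (submod (adjoint_mod U) (M i)) g)"
    and uniqueness: "\<And>U1 U2. extension_structure_on V U U1 \<Longrightarrow> strongly_regular TYPE('x) U1 \<Longrightarrow>
      extension_structure_on V U U2 \<Longrightarrow> strongly_regular TYPE('x) U2 \<Longrightarrow>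
      \<exists>\<Psi>. voa_isomorphism U1 U2 \<Psi> \<and> (\<forall>v\<in>vspace V. \<Psi> v = v)"
  shows "\<exists>g'. voa_automorphism U g' \<and> g' ` vspace V = vspace V \<and> (\<forall>v\<in>vspace V. g' v = g v)"
proof -
  have closed: "mode U v n w \<in> M i" if "i \<le> k" "v \<in> vspace V" "w \<in> M i" for i v n w
    using weak_module.action_closed[of V "submod (adjoint_mod U) (M i)" v w n] irreducible that
    by (simp add: irreducible_module_def voa_module_def submod_def adjoint_mod_def)
  obtain f where f: "mod_iso_map V (twist (adjoint_mod U) g) (adjoint_mod U) f"
    and fg: "\<And>v. v \<in> vspace V \<Longrightarrow> f (g v) = v"
    using twist_iso_extending_inverse[OF g U(1) decomposition closed nonisomorphic twist_in] by blast
  let ?W = "transport_voa f U"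
  have VU: "vspace V \<subseteq> vspace U" using U(1) by (simp add: extension_voa_def)
  have gV: "g ` vspace V = vspace V"
    using g by (simp add: voa_automorphism_def voa_isomorphism_def bij_betw_def)
  have f_lin: "clinear_on (vspace U) f" and f_inj: "inj_on f (vspace U)"
    using f by (simp_all add: mod_iso_map_def twist_def adjoint_mod_def bij_betw_def)
  interpret W: voa_iso U ?W f
    using U(1) voa_isomorphism_transport[OF f_lin f_inj]
    by (simp add: voa_iso_def voa_iso_axioms_def extension_voa_def)
  have "extension_structure_on V U U"
    using U(1) by (simp add: extension_structure_on_def)
  then obtain \<Psi> where \<Psi>: "voa_isomorphism U ?W \<Psi>" "\<And>v. v \<in> vspace V \<Longrightarrow> \<Psi> v = v"
    using uniqueness U(2) extension_structure_on_transport[OF U(1) g f fg]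
      W.strongly_regular_target[OF U(2)] by blast
  let ?g = "inv_into (vspace U) f \<circ> \<Psi>"
  have "voa_automorphism U ?g"
    unfolding voa_automorphism_def by (rule voa_isomorphism_comp[OF \<Psi>(1) W.voa_isomorphism_inv])
  moreover have "?g v = g v" if v: "v \<in> vspace V" for v
  proof -
    have "g v \<in> vspace U" using v gV VU by blast
    then show ?thesis using inv_into_f_f[OF f_inj, of "g v"] fg[OF v] \<Psi>(2)[OF v] by simp
  qed
  moreover from this have "?g ` vspace V = vspace V" using gV by (metis image_cong)
  ultimately show ?thesis by blast
qed

end
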